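(* Let $(V,A^{\psi})$ be a generalized intuitionistic fuzzy $\psi$-normed linear space. If every Cauchy sequence in $(V,A^{\psi})$ has a convergent subsequence, then $(V,A^{\psi})$ is complete.
   Context: Write $\mathbf{R}^{+}=(0,\infty)$. A continuous $t$-norm is a continuous, commutative, associative map $\ast:[0,1]\times[0,1]\to[0,1]$ with $a\ast 1=a$ for all $a$, and $a\ast b\le c\ast d$ whenever $a\le c$, $b\le d$. A continuous $t$-conorm is a continuous, commutative, associative map $\diamond:[0,1]\times[0,1]\to[0,1]$ with $a\diamond 0=a$ for all $a$, and $a\diamond b\le c\diamond d$ whenever $a\le c$, $b\le d$. An operation $\circ$ on $\mathbf{R}^{+}$ is a function $\circ:[0,\infty)\times[0,\infty)\to[0,\infty)$ that is associative, commutative, non-decreasing in each place and satisfies $a\circ 0=a$ for all $a\in[0,\infty)$. $\psi:\mathbf{R}\to\mathbf{R}$ is a function with $\psi(-t)=\psi(t)$ for all $t$; $\psi(1)=1$; $\psi$ strictly increasing and continuous on $(0,\infty)$; $\lim_{\alpha\to 0}\psi(\alpha)=0$ and $\lim_{\alpha\to\infty}\psi(\alpha)=\infty$. Fix such $\ast,\diamond,\circ,\psi$. Let $V$ be a linear space over $\mathbf{R}$ with null vector $\theta$. A generalized intuitionistic fuzzy $\psi$-norm on $V$ is an object $A^{\psi}=\{((x,t),\mu(x,t),\nu(x,t)):(x,t)\in V\times\mathbf{R}^{+}\}$, where $\mu,\nu:V\times\mathbf{R}^{+}\to[0,1]$ satisfy, for all $x,y\in V$ and $s,t\in\mathbf{R}^{+}$: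 (i) $\mu(x,t)+\nu(x,t)\le 1$; (ii) $\mu(x,t)>0$; (iii) $\mu(x,t)=1$ if and only if $x=\theta$; (iv) $\mu(\alpha x,t)=\mu(x,t/\psi(\alpha))$ for all $\alpha\in\mathbf{R}$, $\alpha\ne 0$; (v) $\mu(x,s)\ast\mu(y,t)\le\mu(x+y,s\circ t)$; (vi) $\mu(x,\cdot)$ is non-decreasing on $\mathbf{R}^{+}$ and $\lim_{t\to\infty}\mu(x,t)=1$; (vii) $\nu(x,t)<1$; (viii) $\nu(x,t)=0$ if and only if $x=\theta$; (ix) $\nu(\alpha x,t)=\nu(x,t/\psi(\alpha))$ for all $\alpha\in\mathbf{R}$, $\alpha\neq 0$; (x) $\nu(x,s)\diamond\nu(y,t)\ge\nu(x+y,s\circ t)$; (xi) $\nu(x,\cdot)$ is non-increasing on $\mathbf{R}^{+}$ and $\lim_{t\to\infty}\nu(x,t)=0$. The pair $(V,A^{\psi})$ is then called a generalized intuitionistic fuzzy $\psi$-normed linear space. A sequence $\{x_n\}$ in $V$ converges to $x\in V$ if for every $r\in(0,1)$ and $t>0$ there is $n_0\in\mathbf{N}$ such that $\mu(x_n-x,t)>1-r$ and $\nu(x_n-x,t)<r$ for all $n\ge n_0$. It is a Cauchy sequence if for every $r\in(0,1)$ and $t>0$ there is $n_0\in\mathbf{N}$ such that $\mu(x_m-x_n,t)>1-r$ and $\nu(x_m-x_n,t)<r$ for all $m,n\ge n_0$. $(V,A^{\psi})$ is complete if every Cauchy sequence in it is convergent. *)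

theory Defs
  imports "HOL-Analysis.Analysis"
begin

(* Operations and functions with a restricted domain are represented by total functions;
   every condition is imposed on the original domain only. *)

definition continuous_t_norm :: "(real \<Rightarrow> real \<Rightarrow> real) \<Rightarrow> bool" where
  "continuous_t_norm T \<longleftrightarrow>
     (\<forall>a\<in>{0..1}. \<forall>b\<in>{0..1}. T a b \<in> {0..1}) \<and>
     continuous_on ({0..1} \<times> {0..1}) (\<lambda>(a, b). T a b) \<and>
     (\<forall>a\<in>{0..1}. \<forall>b\<in>{0..1}. T a b = T b a) \<and>
     (\<forall>a\<in>{0..1}. \<forall>b\<in>{0..1}. \<forall>c\<in>{0..1}. T (T a b) c = T a (T b c)) \<and>
     (\<forall>a\<in>{0..1}. T a 1 = a) \<and>
     (\<forall>a\<in>{0..1}. \<forall>b\<in>{0..1}. \<forall>c\<in>{0..1}. \<forall>d\<in>{0..1}. a \<le> c \<longrightarrow> b \<le> d \<longrightarrow> T a b \<le> T c d)"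

definition continuous_t_conorm :: "(real \<Rightarrow> real \<Rightarrow> real) \<Rightarrow> bool" where
  "continuous_t_conorm S \<longleftrightarrow>
     (\<forall>a\<in>{0..1}. \<forall>b\<in>{0..1}. S a b \<in> {0..1}) \<and>
     continuous_on ({0..1} \<times> {0..1}) (\<lambda>(a, b). S a b) \<and>
     (\<forall>a\<in>{0..1}. \<forall>b\<in>{0..1}. S a b = S b a) \<and>
     (\<forall>a\<in>{0..1}. \<forall>b\<in>{0..1}. \<forall>c\<in>{0..1}. S (S a b) c = S a (S b c)) \<and>
     (\<forall>a\<in>{0..1}. S a 0 = a) \<and>
     (\<forall>a\<in>{0..1}. \<forall>b\<in>{0..1}. \<forall>c\<in>{0..1}. \<forall>d\<in>{0..1}. a \<le> c \<longrightarrow> b \<le> d \<longrightarrow> S a b \<le> S c d)"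

definition pos_real_operation :: "(real \<Rightarrow> real \<Rightarrow> real) \<Rightarrow> bool" where
  "pos_real_operation R \<longleftrightarrow>
     (\<forall>a\<ge>0. \<forall>b\<ge>0. R a b \<ge> 0) \<and>
     (\<forall>a\<ge>0. \<forall>b\<ge>0. \<forall>c\<ge>0. R (R a b) c = R a (R b c)) \<and>
     (\<forall>a\<ge>0. \<forall>b\<ge>0. R a b = R b a) \<and>
     (\<forall>b\<ge>0. mono_on {0..} (\<lambda>a. R a b)) \<and>
     (\<forall>a\<ge>0. mono_on {0..} (\<lambda>b. R a b)) \<and>
     (\<forall>a\<ge>0. R a 0 = a)"

(* No condition is placed on the value at 0: the limit at 0 is the punctured one. *)
definition psi_function :: "(real \<Rightarrow> real) \<Rightarrow> bool" where
  "psi_function \<psi> \<longleftrightarrow>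
     (\<forall>t. \<psi> (- t) = \<psi> t) \<and>
     \<psi> 1 = 1 \<and>
     strict_mono_on {0<..} \<psi> \<and>
     continuous_on {0<..} \<psi> \<and>
     (\<psi> \<longlongrightarrow> 0) (at 0) \<and>
     filterlim \<psi> at_top at_top"

(* The set of tuples ((x, t), mu (x, t), nu (x, t)) is given by its membership function \<mu> and
   its non-membership function \<nu>; their values at t \<le> 0 are irrelevant. *)
definition gif_psi_norm ::
  "(real \<Rightarrow> real \<Rightarrow> real) \<Rightarrow> (real \<Rightarrow> real \<Rightarrow> real) \<Rightarrow> (real \<Rightarrow> real \<Rightarrow> real) \<Rightarrow> (real \<Rightarrow> real) \<Rightarrow>
   ('v::real_vector \<Rightarrow> real \<Rightarrow> real) \<Rightarrow> ('v \<Rightarrow> real \<Rightarrow> real) \<Rightarrow> bool" where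
  "gif_psi_norm T S R \<psi> \<mu> \<nu> \<longleftrightarrow>
     (\<forall>x. \<forall>t>0. \<mu> x t \<in> {0..1} \<and> \<nu> x t \<in> {0..1}) \<and>
     (\<forall>x. \<forall>t>0. \<mu> x t + \<nu> x t \<le> 1) \<and>
     (\<forall>x. \<forall>t>0. \<mu> x t > 0) \<and>
     (\<forall>x. \<forall>t>0. \<mu> x t = 1 \<longleftrightarrow> x = 0) \<and>
     (\<forall>x. \<forall>t>0. \<forall>\<alpha>. \<alpha> \<noteq> 0 \<longrightarrow> \<mu> (\<alpha> *\<^sub>R x) t = \<mu> x (t / \<psi> \<alpha>)) \<and>
     (\<forall>x y. \<forall>s>0. \<forall>t>0. T (\<mu> x s) (\<mu> y t) \<le> \<mu> (x + y) (R s t)) \<and>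
     (\<forall>x. mono_on {0<..} (\<mu> x) \<and> (\<mu> x \<longlongrightarrow> 1) at_top) \<and>
     (\<forall>x. \<forall>t>0. \<nu> x t < 1) \<and>
     (\<forall>x. \<forall>t>0. \<nu> x t = 0 \<longleftrightarrow> x = 0) \<and>
     (\<forall>x. \<forall>t>0. \<forall>\<alpha>. \<alpha> \<noteq> 0 \<longrightarrow> \<nu> (\<alpha> *\<^sub>R x) t = \<nu> x (t / \<psi> \<alpha>)) \<and>
     (\<forall>x y. \<forall>s>0. \<forall>t>0. S (\<nu> x s) (\<nu> y t) \<ge> \<nu> (x + y) (R s t)) \<and>
     (\<forall>x. antimono_on {0<..} (\<nu> x) \<and> (\<nu> x \<longlongrightarrow> 0) at_top)"

definition gif_converges ::
  "('v::real_vector \<Rightarrow> real \<Rightarrow> real) \<Rightarrow> ('v \<Rightarrow> real \<Rightarrow> real) \<Rightarrow> (nat \<Rightarrow> 'v) \<Rightarrow> 'v \<Rightarrow> bool" where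
  "gif_converges \<mu> \<nu> X x \<longleftrightarrow>
     (\<forall>r\<in>{0<..<1}. \<forall>t>0. \<exists>n0. \<forall>n\<ge>n0. \<mu> (X n - x) t > 1 - r \<and> \<nu> (X n - x) t < r)"

definition gif_convergent ::
  "('v::real_vector \<Rightarrow> real \<Rightarrow> real) \<Rightarrow> ('v \<Rightarrow> real \<Rightarrow> real) \<Rightarrow> (nat \<Rightarrow> 'v) \<Rightarrow> bool" where
  "gif_convergent \<mu> \<nu> X \<longleftrightarrow> (\<exists>x. gif_converges \<mu> \<nu> X x)"

definition gif_Cauchy ::
  "('v::real_vector \<Rightarrow> real \<Rightarrow> real) \<Rightarrow> ('v \<Rightarrow> real \<Rightarrow> real) \<Rightarrow> (nat \<Rightarrow> 'v) \<Rightarrow> bool" where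
  "gif_Cauchy \<mu> \<nu> X \<longleftrightarrow>
     (\<forall>r\<in>{0<..<1}. \<forall>t>0. \<exists>n0. \<forall>m\<ge>n0. \<forall>n\<ge>n0. \<mu> (X m - X n) t > 1 - r \<and> \<nu> (X m - X n) t < r)"

definition gif_complete ::
  "('v::real_vector \<Rightarrow> real \<Rightarrow> real) \<Rightarrow> ('v \<Rightarrow> real \<Rightarrow> real) \<Rightarrow> bool" where
  "gif_complete \<mu> \<nu> \<longleftrightarrow> (\<forall>X. gif_Cauchy \<mu> \<nu> X \<longrightarrow> gif_convergent \<mu> \<nu> X)"

end

theory Submission imports Defs
begin

text \<open>
  As in a metric space, a Cauchy sequence with a convergent subsequence converges to the limit of
  that subsequence: write \<open>X n - x = (X n - X (f n)) + (X (f n) - x)\<close>, make the first difference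
  small by the Cauchy property and the second by convergence, and combine the two by the triangle
  inequalities and the continuity of the t-norm at \<open>(1, 1)\<close> and of the t-conorm at \<open>(0, 0)\<close>.

  The difficulty is the time parameter. The triangle inequality controls \<open>x + y\<close> only at time
  \<open>R s s\<close>, and \<open>R\<close> need not be continuous: for instance \<open>R a b = max a (max b 1)\<close> for positive
  \<open>a\<close> and \<open>b\<close> never takes a value below \<open>1\<close> there, so that no choice of \<open>s\<close> makes \<open>R s s\<close> small.
  Homogeneity removes the obstacle. The triangle inequality for \<open>\<alpha> x\<close> and \<open>\<alpha> y\<close> at time \<open>1\<close> is
  an inequality for \<open>x\<close> and \<open>y\<close> at time \<open>1 / \<psi> \<alpha>\<close> that controls \<open>x + y\<close> at time
  \<open>R 1 1 / \<psi> \<alpha>\<close>, and this tends to \<open>0\<close> as \<open>\<alpha>\<close> grows (lemma \<open>gif_psi_norm_triangle_rescaled\<close>).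
\<close>

lemma continuous_on_unit_square_at_idempotent:
  fixes F :: "real \<Rightarrow> real \<Rightarrow> real"
  assumes cont: "continuous_on ({0..1} \<times> {0..1}) (\<lambda>(a, b). F a b)"
    and e: "e \<in> {0..1}" "F e e = e" and "r > 0"
  obtains d where "d \<in> {0<..<1}"
    "\<And>a b. a \<in> {0..1} \<Longrightarrow> b \<in> {0..1} \<Longrightarrow> \<bar>a - e\<bar> < d \<Longrightarrow> \<bar>b - e\<bar> < d \<Longrightarrow> \<bar>F a b - e\<bar> < r"
proof -
  obtain d where d: "d > 0"
    "\<And>p. p \<in> {0..1} \<times> {0..1} \<Longrightarrow> dist p (e, e) < d
      \<Longrightarrow> dist ((\<lambda>(a, b). F a b) p) ((\<lambda>(a, b). F a b) (e, e)) < r"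
    using cont e(1) \<open>r > 0\<close> unfolding continuous_on_iff by (metis mem_Sigma_iff)
  show thesis
  proof
    show "min (d / 2) (1 / 2) \<in> {0<..<1}"
      using d(1) by auto
    fix a b :: real
    assume ab: "a \<in> {0..1}" "b \<in> {0..1}"
      "\<bar>a - e\<bar> < min (d / 2) (1 / 2)" "\<bar>b - e\<bar> < min (d / 2) (1 / 2)"
    have "dist (a, b) (e, e) \<le> \<bar>a - e\<bar> + \<bar>b - e\<bar>"
      using sqrt_sum_squares_le_sum_abs[of "a - e" "b - e"] by (simp add: dist_Pair_Pair dist_real_def)
    also have "\<dots> < d"
      using ab by linarith
    finally show "\<bar>F a b - e\<bar> < r"
      using d(2)[of "(a, b)"] ab e(2) by (simp add: dist_real_def)
  qed
qed

text \<open>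
  This replaces the choice of \<open>s\<close> with \<open>R s s \<le> t\<close>, which is possible only when \<open>R\<close> is
  continuous at the origin. One \<open>s\<close> serves all vectors, because it depends on \<open>t\<close>, \<open>R\<close> and
  \<open>\<psi>\<close> alone.
\<close>

lemma gif_psi_norm_triangle_rescaled:
  fixes \<mu> \<nu> :: "'v::real_vector \<Rightarrow> real \<Rightarrow> real"
  assumes R: "pos_real_operation R" and psi: "psi_function \<psi>"
    and N: "gif_psi_norm T S R \<psi> \<mu> \<nu>" and "t > 0"
  obtains s where "s > 0"
    "\<And>x y. T (\<mu> x s) (\<mu> y s) \<le> \<mu> (x + y) t"
    "\<And>x y. \<nu> (x + y) t \<le> S (\<nu> x s) (\<nu> y s)"
proof -
  have "mono_on {0..} (R 1)" "R 1 0 = 1"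
    using R unfolding pos_real_operation_def by auto
  hence R11: "R 1 1 \<ge> 1"
    using mono_onD[of "{0..}" "R 1" 0 1] by simp
  have "\<forall>\<^sub>F \<alpha> in at_top. R 1 1 / t \<le> \<psi> \<alpha>"
    using psi unfolding psi_function_def filterlim_at_top by blast
  then obtain c where c: "\<And>\<alpha>. \<alpha> \<ge> c \<Longrightarrow> R 1 1 / t \<le> \<psi> \<alpha>"
    unfolding eventually_at_top_linorder by blast
  define \<alpha> where "\<alpha> = max c 1"
  have \<alpha>: "\<alpha> > 0" "R 1 1 / t \<le> \<psi> \<alpha>"
    using c[of \<alpha>] by (auto simp: \<alpha>_def)
  have pos: "\<psi> \<alpha> > 0"
    using R11 \<open>t > 0\<close> \<alpha>(2) by (smt (verit) divide_pos_pos)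
  have le: "R 1 1 / \<psi> \<alpha> \<le> t" "R 1 1 / \<psi> \<alpha> > 0"
    using R11 pos \<open>t > 0\<close> \<alpha>(2) by (auto simp: field_simps)
  have mu_scale: "\<mu> (\<alpha> *\<^sub>R z) u = \<mu> z (u / \<psi> \<alpha>)"
    and nu_scale: "\<nu> (\<alpha> *\<^sub>R z) u = \<nu> z (u / \<psi> \<alpha>)" if "u > 0" for z u
    using N \<alpha>(1) that unfolding gif_psi_norm_def by auto
  show thesis
  proof
    show "1 / \<psi> \<alpha> > 0"
      using pos by simp
    fix x y
    have "T (\<mu> (\<alpha> *\<^sub>R x) 1) (\<mu> (\<alpha> *\<^sub>R y) 1) \<le> \<mu> (\<alpha> *\<^sub>R x + \<alpha> *\<^sub>R y) (R 1 1)"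
      using N unfolding gif_psi_norm_def by auto
    hence "T (\<mu> x (1 / \<psi> \<alpha>)) (\<mu> y (1 / \<psi> \<alpha>)) \<le> \<mu> (x + y) (R 1 1 / \<psi> \<alpha>)"
      using R11 by (simp add: mu_scale flip: scaleR_add_right)
    also have "\<dots> \<le> \<mu> (x + y) t"
      using N le \<open>t > 0\<close> unfolding gif_psi_norm_def by (auto simp: mono_on_def)
    finally show "T (\<mu> x (1 / \<psi> \<alpha>)) (\<mu> y (1 / \<psi> \<alpha>)) \<le> \<mu> (x + y) t" .
    have "\<nu> (x + y) t \<le> \<nu> (x + y) (R 1 1 / \<psi> \<alpha>)"
      using N le \<open>t > 0\<close> unfolding gif_psi_norm_def by (auto simp: monotone_on_def)
    also have "\<nu> (\<alpha> *\<^sub>R x + \<alpha> *\<^sub>R y) (R 1 1) \<le> S (\<nu> (\<alpha> *\<^sub>R x) 1) (\<nu> (\<alpha> *\<^sub>R y) 1)"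
      using N unfolding gif_psi_norm_def by auto
    hence "\<nu> (x + y) (R 1 1 / \<psi> \<alpha>) \<le> S (\<nu> x (1 / \<psi> \<alpha>)) (\<nu> y (1 / \<psi> \<alpha>))"
      using R11 by (simp add: nu_scale flip: scaleR_add_right)
    finally show "\<nu> (x + y) t \<le> S (\<nu> x (1 / \<psi> \<alpha>)) (\<nu> y (1 / \<psi> \<alpha>))" .
  qed
qed

lemma gif_Cauchy_converges_if_subseq_converges:
  fixes \<mu> \<nu> :: "'v::real_vector \<Rightarrow> real \<Rightarrow> real"
  assumes T: "continuous_t_norm T" and S: "continuous_t_conorm S"
    and R: "pos_real_operation R" and psi: "psi_function \<psi>"
    and N: "gif_psi_norm T S R \<psi> \<mu> \<nu>"
    and Cauchy: "gif_Cauchy \<mu> \<nu> X"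
    and f: "strict_mono f" and lim: "gif_converges \<mu> \<nu> (X \<circ> f) x"
  shows "gif_converges \<mu> \<nu> X x"
  unfolding gif_converges_def
proof (intro ballI allI impI)
  fix r t :: real
  assume r: "r \<in> {0<..<1}" and t: "t > 0"
  obtain s where s: "s > 0"
    "\<And>x y. T (\<mu> x s) (\<mu> y s) \<le> \<mu> (x + y) t"
    "\<And>x y. \<nu> (x + y) t \<le> S (\<nu> x s) (\<nu> y s)"
    using gif_psi_norm_triangle_rescaled[OF R psi N t] by blast
  obtain dT where dT: "dT \<in> {0<..<1}"
    "\<And>a b. a \<in> {0..1} \<Longrightarrow> b \<in> {0..1} \<Longrightarrow> \<bar>a - 1\<bar> < dT \<Longrightarrow> \<bar>b - 1\<bar> < dT \<Longrightarrow> \<bar>T a b - 1\<bar> < r"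
    using continuous_on_unit_square_at_idempotent[of T 1 r] T r
    unfolding continuous_t_norm_def by auto
  obtain dS where dS: "dS \<in> {0<..<1}"
    "\<And>a b. a \<in> {0..1} \<Longrightarrow> b \<in> {0..1} \<Longrightarrow> \<bar>a - 0\<bar> < dS \<Longrightarrow> \<bar>b - 0\<bar> < dS \<Longrightarrow> \<bar>S a b - 0\<bar> < r"
    using continuous_on_unit_square_at_idempotent[of S 0 r] S r
    unfolding continuous_t_conorm_def by auto
  define d where "d = min dT dS"
  have d: "d \<in> {0<..<1}" "d \<le> dT" "d \<le> dS"
    using dT(1) dS(1) by (auto simp: d_def)
  obtain n1 where n1: "\<And>m n. m \<ge> n1 \<Longrightarrow> n \<ge> n1
      \<Longrightarrow> \<mu> (X m - X n) s > 1 - d \<and> \<nu> (X m - X n) s < d"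
    using Cauchy d(1) s(1) unfolding gif_Cauchy_def by meson
  obtain n2 where n2: "\<And>n. n \<ge> n2
      \<Longrightarrow> \<mu> (X (f n) - x) s > 1 - d \<and> \<nu> (X (f n) - x) s < d"
    using lim d(1) s(1) unfolding gif_converges_def comp_def by meson
  have unit: "\<mu> z s \<in> {0..1}" "\<nu> z s \<in> {0..1}" for z
    using N s(1) unfolding gif_psi_norm_def by auto
  show "\<exists>n0. \<forall>n\<ge>n0. \<mu> (X n - x) t > 1 - r \<and> \<nu> (X n - x) t < r"
  proof (intro exI allI impI)
    fix n
    assume n: "n \<ge> max n1 n2"
    define u v where "u = X n - X (f n)" and "v = X (f n) - x"
    have split: "X n - x = u + v"
      by (simp add: u_def v_def)
    have "f n \<ge> n"
      using f by (rule strict_mono_imp_increasing)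
    hence uv: "\<mu> u s > 1 - d" "\<nu> u s < d" "\<mu> v s > 1 - d" "\<nu> v s < d"
      using n n1[of n "f n"] n2[of n] by (auto simp: u_def v_def)
    have "\<bar>T (\<mu> u s) (\<mu> v s) - 1\<bar> < r"
      using dT(2)[OF unit(1)[of u] unit(1)[of v]] uv unit[of u] unit[of v] d(2) by auto
    moreover have "\<bar>S (\<nu> u s) (\<nu> v s) - 0\<bar> < r"
      using dS(2)[OF unit(2)[of u] unit(2)[of v]] uv unit[of u] unit[of v] d(3) by auto
    ultimately show "\<mu> (X n - x) t > 1 - r \<and> \<nu> (X n - x) t < r"
      unfolding split using s(2)[of u v] s(3)[of u v] by linarith
  qed
qed

theorem theorem3p13:
  fixes T S R :: "real \<Rightarrow> real \<Rightarrow> real"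
    and \<psi> :: "real \<Rightarrow> real"
    and \<mu> \<nu> :: "'v::real_vector \<Rightarrow> real \<Rightarrow> real"
  assumes "continuous_t_norm T"
    and "continuous_t_conorm S"
    and "pos_real_operation R"
    and "psi_function \<psi>"
    and "gif_psi_norm T S R \<psi> \<mu> \<nu>"
    and "\<And>X. gif_Cauchy \<mu> \<nu> X \<Longrightarrow> \<exists>f. strict_mono f \<and> gif_convergent \<mu> \<nu> (X \<circ> f)"
  shows "gif_complete \<mu> \<nu>"
  unfolding gif_complete_def
proof (intro allI impI)
  fix X
  assume X: "gif_Cauchy \<mu> \<nu> X"
  obtain f x where "strict_mono f" "gif_converges \<mu> \<nu> (X \<circ> f) x"
    using assms(6)[OF X] unfolding gif_convergent_def by blast
  then show "gif_convergent \<mu> \<nu> X"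
    unfolding gif_convergent_def
    using gif_Cauchy_converges_if_subseq_converges[OF assms(1-5) X] by blast
qed

end
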